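(* Fix real numbers $\delta_1,\delta_2,\epsilon>0$ and a function $f\colon X\times Y\to[0,1]$ with $X,Y$ finite nonempty sets. Suppose $A\subseteq X$ and $B\subseteq Y$ are such that the pair $(A,B)$ is weakly $(\delta_1,\delta_2;\epsilon)$-good with respect to $f$. Then $(A,B)$ is $4\epsilon$-almost $(\delta_1+\delta_2)$-constant with respect to $f$.
   Context: A function $\phi\colon V\to[0,1]$ is $\delta$-constant on $W\subseteq V$ if $|\phi(v)-\phi(v')|<\delta$ for all $v,v'\in W$. Weakly good pairs: for $f\colon X\times Y\to[0,1]$, $A\subseteq X$, $B\subseteq Y$ and $\delta_1,\delta_2,\epsilon>0$, the pair $(A,B)$ is weakly $(\delta_1,\delta_2;\epsilon)$-good with respect to $f$ if both of the following hold: (i) there is $E\subseteq A\times B$ with $|E|<\epsilon|A||B|$ such that for every $y\in B$ the function $x\mapsto f(x,y)$ is $\delta_1$-constant on $\{x\in A:(x,y)\notin E\}$; (ii) there is $F\subseteq A\times B$ with $|F|<\epsilon|A||B|$ such that for every $x\in A$ the function $y\mapsto f(x,y)$ is $\delta_2$-constant on $\{y\in B:(x,y)\notin F\}$. Almost constant pairs: for $A\subseteq X$, $B\subseteq Y$ and $\delta,\epsilon>0$, the pair $(A,B)$ is $\epsilon$-almost $\delta$-constant with respect to $f$ if there is $E\subseteq A\times B$ with $|E|>(1-\epsilon)|A||B|$ such that $|f(x,y)-f(x',y')|<\delta$ for any $(x,y),(x',y')\in E$. *)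

theory Defs
  imports Complex_Main "HOL-Library.FuncSet"
begin

definition delta_constant_on :: "real \<Rightarrow> ('a \<Rightarrow> real) \<Rightarrow> 'a set \<Rightarrow> bool" where
  "delta_constant_on \<delta> \<phi> W \<longleftrightarrow> (\<forall>v\<in>W. \<forall>v'\<in>W. \<bar>\<phi> v - \<phi> v'\<bar> < \<delta>)"

text \<open>
  The two notions below are meant for subsets \<open>A\<close>, \<open>B\<close> of finite sets (so that \<open>card\<close> is the true
  number of elements) and for positive parameters. The strict inequalities make no exception for
  an empty \<open>A\<close> or \<open>B\<close>, in which case neither property can hold.
\<close>

definition weakly_good ::
  "('a \<times> 'b \<Rightarrow> real) \<Rightarrow> real \<Rightarrow> real \<Rightarrow> real \<Rightarrow> 'a set \<Rightarrow> 'b set \<Rightarrow> bool" where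
  "weakly_good f \<delta>\<^sub>1 \<delta>\<^sub>2 \<epsilon> A B \<longleftrightarrow>
    (\<exists>E \<subseteq> A \<times> B. real (card E) < \<epsilon> * real (card A) * real (card B) \<and>
       (\<forall>y\<in>B. delta_constant_on \<delta>\<^sub>1 (\<lambda>x. f (x, y)) {x \<in> A. (x, y) \<notin> E})) \<and>
    (\<exists>F \<subseteq> A \<times> B. real (card F) < \<epsilon> * real (card A) * real (card B) \<and>
       (\<forall>x\<in>A. delta_constant_on \<delta>\<^sub>2 (\<lambda>y. f (x, y)) {y \<in> B. (x, y) \<notin> F}))"

definition almost_constant ::
  "('a \<times> 'b \<Rightarrow> real) \<Rightarrow> real \<Rightarrow> real \<Rightarrow> 'a set \<Rightarrow> 'b set \<Rightarrow> bool" where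
  "almost_constant f \<epsilon> \<delta> A B \<longleftrightarrow>
    (\<exists>E \<subseteq> A \<times> B. real (card E) > (1 - \<epsilon>) * real (card A) * real (card B) \<and>
       (\<forall>(x, y)\<in>E. \<forall>(x', y')\<in>E. \<bar>f (x, y) - f (x', y')\<bar> < \<delta>))"

end

theory Submission
  imports Defs
begin

text \<open>
  Outside \<open>E\<close> and \<open>F\<close>, the value \<open>f (x, y)\<close> lies in \<open>[m y, m y + \<delta>\<^sub>1)\<close> and in
  \<open>[n x, n x + \<delta>\<^sub>2)\<close>. For a threshold \<open>T\<close>, call \<open>y\<close> low if \<open>m y < T\<close> and high if
  \<open>m y \<ge> T + \<delta>\<^sub>2\<close>, and call \<open>x\<close> low if \<open>n x < T\<close> and high if \<open>n x \<ge> T + \<delta>\<^sub>1\<close>. A point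
  outside \<open>E \<union> F\<close> has its value in \<open>[T, T + \<delta>\<^sub>1 + \<delta>\<^sub>2)\<close> unless its coordinates are both low
  or both high, while every point with one low and one high coordinate lies in \<open>E \<union> F\<close>. If there
  are as many low as high \<open>y\<close>, then the points of the first kind are as numerous as those of the
  second, so fewer than \<open>2\<epsilon>|A||B|\<close>, and discarding them together with \<open>E \<union> F\<close> suffices. Such a
  balanced \<open>T\<close> is a median of the numbers \<open>m y\<close> and \<open>m y - \<delta>\<^sub>2\<close>; ties at the median are
  resolved according to whether low or high \<open>x\<close> prevail.
\<close>

text \<open>Take the least value of \<open>g\<close> with at least half of \<open>S\<close> at or
  below it. If more than half of \<open>S\<close> lay strictly below, the largest value attained
  there would be a smaller candidate.\<close>

lemma median_exists:
  fixes g :: "'a \<Rightarrow> 'b::linorder"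
  assumes "finite S" and "S \<noteq> {}"
  obtains T where "2 * card {s \<in> S. g s < T} \<le> card S" and "card S \<le> 2 * card {s \<in> S. g s \<le> T}"
proof -
  define V where "V = {t \<in> g ` S. card S \<le> 2 * card {s \<in> S. g s \<le> t}}"
  have "finite V"
    using assms by (simp add: V_def)
  have "{s \<in> S. g s \<le> Max (g ` S)} = S"
    using assms by auto
  then have "Max (g ` S) \<in> V"
    using assms by (simp add: V_def)
  then have min: "Min V \<in> V" "\<And>t. t \<in> V \<Longrightarrow> Min V \<le> t"
    using \<open>finite V\<close> by (auto intro: Min_in)
  define R where "R = {s \<in> S. g s < Min V}"
  have "2 * card R \<le> card S"
  proof (rule ccontr)
    assume large: "\<not> 2 * card R \<le> card S"
    then have "R \<noteq> {}" by auto
    have "finite R"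
      using assms by (simp add: R_def)
    define t where "t = Max (g ` R)"
    have t: "t \<in> g ` R"
      unfolding t_def using \<open>finite R\<close> \<open>R \<noteq> {}\<close> by (intro Max_in) auto
    have "R \<subseteq> {s \<in> S. g s \<le> t}"
      using \<open>finite R\<close> by (auto simp: t_def R_def)
    then have "card R \<le> card {s \<in> S. g s \<le> t}"
      using assms by (intro card_mono) auto
    then have "t \<in> V"
      using t large by (auto simp: V_def R_def)
    then show False
      using min(2)[of t] t by (auto simp: R_def)
  qed
  then show thesis
    using that[of "Min V"] min(1) by (simp add: V_def R_def)
qed

lemma balanced_threshold:
  fixes m :: "'a \<Rightarrow> real"
  assumes "finite B" and "B \<noteq> {}"
  obtains T where "card {y \<in> B. m y < T} \<le> card {y \<in> B. T + d \<le> m y}"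
    and "card {y \<in> B. T + d < m y} \<le> card {y \<in> B. m y \<le> T}"
proof -
  \<comment> \<open>The disjoint sum keeps all \<open>2 * card B\<close> numbers with multiplicity.
    Within \<open>B\<close>, the condition \<open>m y - d < T\<close> is complementary to
    \<open>T + d \<le> m y\<close>, which turns the median bounds into comparisons of low with
    high.\<close>
  define g where "g = case_sum m (\<lambda>y. m y - d)"
  have "finite (B <+> B)" "B <+> B \<noteq> {}"
    using assms by auto
  then obtain T where T: "2 * card {s \<in> B <+> B. g s < T} \<le> card (B <+> B)"
      "card (B <+> B) \<le> 2 * card {s \<in> B <+> B. g s \<le> T}"
    by (rule median_exists)
  have "{s \<in> B <+> B. g s < T} = {y \<in> B. m y < T} <+> {y \<in> B. m y - d < T}"
    "{s \<in> B <+> B. g s \<le> T} = {y \<in> B. m y \<le> T} <+> {y \<in> B. m y - d \<le> T}"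
    by (auto simp: g_def)
  then have "card {y \<in> B. m y < T} + card {y \<in> B. m y - d < T} \<le> card B"
    "card B \<le> card {y \<in> B. m y \<le> T} + card {y \<in> B. m y - d \<le> T}"
    using T assms by (simp_all add: card_Plus)
  moreover have "card {y \<in> B. m y - d < T} + card {y \<in> B. T + d \<le> m y} = card B"
    "card {y \<in> B. m y - d \<le> T} + card {y \<in> B. T + d < m y} = card B"
    using assms by (subst card_Un_disjoint[symmetric]; auto intro!: arg_cong[where f = card])+
  ultimately show thesis
    by (intro that[of T]) linarith+
qed

text \<open>The minimum is attained on a finite nonempty \<open>W\<close>, so the upper bound stays
  strict.\<close>

lemma delta_constant_on_lower_bound:
  assumes "finite W" and "delta_constant_on \<delta> \<phi> W"
  shows "\<exists>m. \<forall>v\<in>W. m \<le> \<phi> v \<and> \<phi> v < m + \<delta>"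
proof (cases "W = {}")
  case False
  then have "Min (\<phi> ` W) \<in> \<phi> ` W"
    using assms by (intro Min_in) auto
  then obtain w where w: "w \<in> W" "Min (\<phi> ` W) = \<phi> w"
    by auto
  have "\<phi> w \<le> \<phi> v \<and> \<phi> v < \<phi> w + \<delta>" if "v \<in> W" for v
  proof
    show "\<phi> w \<le> \<phi> v"
      using assms that by (simp flip: w(2))
    show "\<phi> v < \<phi> w + \<delta>"
      using assms(2) w(1) that by (fastforce simp: delta_constant_on_def abs_less_iff)
  qed
  then show ?thesis
    by blast
qed simp

lemma almost_constantI:
  assumes "finite A" and "finite B" and "D \<subseteq> A \<times> B"
    and "real (card D) < \<epsilon> * real (card A) * real (card B)"
    and "\<And>x y. x \<in> A \<Longrightarrow> y \<in> B \<Longrightarrow> (x, y) \<notin> D \<Longrightarrow> T \<le> f (x, y) \<and> f (x, y) < T + \<delta>"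
  shows "almost_constant f \<epsilon> \<delta> A B"
  unfolding almost_constant_def
proof (intro exI[of _ "A \<times> B - D"] conjI)
  have "card (A \<times> B - D) + card D = card A * card B"
    using assms(1-3) by (metis card_Diff_subset card_cartesian_product card_mono
        finite_SigmaI finite_subset le_add_diff_inverse2)
  then have "real (card (A \<times> B - D)) + real (card D) = real (card A) * real (card B)"
    by (metis of_nat_add of_nat_mult)
  then show "real (card (A \<times> B - D)) > (1 - \<epsilon>) * real (card A) * real (card B)"
    using assms(4) by (simp add: algebra_simps)
  show "\<forall>(x, y)\<in>A \<times> B - D. \<forall>(x', y')\<in>A \<times> B - D. \<bar>f (x, y) - f (x', y')\<bar> < \<delta>"
  proof (clarify, goal_cases)
    case (1 x y x' y')
    then show ?case
      using assms(5)[of x y] assms(5)[of x' y'] by auto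
  qed
qed auto

text \<open>The two sides differ by \<open>(p - q) * (h - l)\<close>.\<close>

lemma rearrangement_nat:
  fixes l h p q :: nat
  assumes "l \<le> h" and "q \<le> p"
  shows "p * l + q * h \<le> q * l + p * h"
proof -
  obtain i j where "h = l + i" "p = q + j"
    using assms by (meson le_Suc_ex)
  then show ?thesis
    by (simp add: algebra_simps)
qed

theorem lemma2p6:
  fixes \<delta>\<^sub>1 \<delta>\<^sub>2 \<epsilon> :: real
    and X :: "'a set" and Y :: "'b set"
    and f :: "'a \<times> 'b \<Rightarrow> real"
    and A :: "'a set" and B :: "'b set"
  assumes "\<delta>\<^sub>1 > 0" and "\<delta>\<^sub>2 > 0" and "\<epsilon> > 0"
    and "finite X" and "X \<noteq> {}" and "finite Y" and "Y \<noteq> {}"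
    and "f \<in> (X \<times> Y) \<rightarrow> {0..1}"
    and "A \<subseteq> X" and "B \<subseteq> Y"
    and "weakly_good f \<delta>\<^sub>1 \<delta>\<^sub>2 \<epsilon> A B"
  shows "almost_constant f (4 * \<epsilon>) (\<delta>\<^sub>1 + \<delta>\<^sub>2) A B"
proof -
  have fin: "finite A" "finite B"
    using assms by (auto intro: finite_subset)
  obtain E F where
    E: "E \<subseteq> A \<times> B" "real (card E) < \<epsilon> * real (card A) * real (card B)"
      "\<And>y. y \<in> B \<Longrightarrow> delta_constant_on \<delta>\<^sub>1 (\<lambda>x. f (x, y)) {x \<in> A. (x, y) \<notin> E}" and
    F: "F \<subseteq> A \<times> B" "real (card F) < \<epsilon> * real (card A) * real (card B)"
      "\<And>x. x \<in> A \<Longrightarrow> delta_constant_on \<delta>\<^sub>2 (\<lambda>y. f (x, y)) {y \<in> B. (x, y) \<notin> F}"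
    using assms(11) unfolding weakly_good_def by blast
  \<comment> \<open>Otherwise the strict bound would make \<open>card E\<close> negative.\<close>
  have "B \<noteq> {}"
    using E(2) by auto
  have "\<exists>m. \<forall>y\<in>B. \<forall>x\<in>{x \<in> A. (x, y) \<notin> E}. m y \<le> f (x, y) \<and> f (x, y) < m y + \<delta>\<^sub>1"
    using fin E(3) by (intro bchoice ballI delta_constant_on_lower_bound) auto
  then obtain m where m: "\<And>x y. x \<in> A \<Longrightarrow> y \<in> B \<Longrightarrow> (x, y) \<notin> E \<Longrightarrow> m y \<le> f (x, y) \<and> f (x, y) < m y + \<delta>\<^sub>1"
    by blast
  have "\<exists>n. \<forall>x\<in>A. \<forall>y\<in>{y \<in> B. (x, y) \<notin> F}. n x \<le> f (x, y) \<and> f (x, y) < n x + \<delta>\<^sub>2"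
    using fin F(3) by (intro bchoice ballI delta_constant_on_lower_bound) auto
  then obtain n where n: "\<And>x y. x \<in> A \<Longrightarrow> y \<in> B \<Longrightarrow> (x, y) \<notin> F \<Longrightarrow> n x \<le> f (x, y) \<and> f (x, y) < n x + \<delta>\<^sub>2"
    by blast
  obtain T where T: "card {y \<in> B. m y < T} \<le> card {y \<in> B. T + \<delta>\<^sub>2 \<le> m y}"
      "card {y \<in> B. T + \<delta>\<^sub>2 < m y} \<le> card {y \<in> B. m y \<le> T}"
    using balanced_threshold[OF fin(2) \<open>B \<noteq> {}\<close>] by blast
  define P where "P = {x \<in> A. n x < T}"
  define Q where "Q = {x \<in> A. T + \<delta>\<^sub>1 \<le> n x}"
  \<comment> \<open>Points of \<open>B\<close> tied at \<open>T\<close> or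
    \<open>T + \<delta>\<^sub>2\<close> may go either way; the larger of \<open>P\<close> and
    \<open>Q\<close> decides which bound in \<open>T\<close> is used.\<close>
  obtain L H where
    L: "{y \<in> B. m y < T} \<subseteq> L" "L \<subseteq> {y \<in> B. m y \<le> T}" and
    H: "{y \<in> B. T + \<delta>\<^sub>2 < m y} \<subseteq> H" "H \<subseteq> {y \<in> B. T + \<delta>\<^sub>2 \<le> m y}" and
    le: "card P * card L + card Q * card H \<le> card Q * card L + card P * card H"
  proof (cases "card Q \<le> card P")
    case True
    show thesis
      by (rule that[OF _ _ _ _ rearrangement_nat[OF T(1) True]]) auto
  next
    case False
    then have "card P \<le> card Q" by simp
    from rearrangement_nat[OF T(2) this] show thesis
      by (intro that[of "{y \<in> B. m y \<le> T}" "{y \<in> B. T + \<delta>\<^sub>2 < m y}"]) auto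
  qed
  have finLH: "finite L" "finite H" and finPQ: "finite P" "finite Q"
    using fin L(2) H(2) by (auto simp: P_def Q_def intro: finite_subset)
  have finEF: "finite (E \<union> F)"
    using E(1) F(1) fin by (meson finite_SigmaI finite_Un finite_subset)
  have "L \<inter> H = {}"
    using L(2) H(2) \<open>\<delta>\<^sub>2 > 0\<close> by force
  then have "card Q * card L + card P * card H = card (Q \<times> L \<union> P \<times> H)"
    using finLH finPQ by (subst card_Un_disjoint) (auto simp: card_cartesian_product)
  also have "\<dots> \<le> card (E \<union> F)"
  proof (rule card_mono[OF finEF], rule subsetI)
    fix z assume z: "z \<in> Q \<times> L \<union> P \<times> H"
    then obtain x y where xy: "z = (x, y)" "x \<in> A" "y \<in> B"
      "n x < T \<and> T + \<delta>\<^sub>2 \<le> m y \<or> T + \<delta>\<^sub>1 \<le> n x \<and> m y \<le> T"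
      using L(2) H(2) by (auto simp: P_def Q_def)
    \<comment> \<open>Outside \<open>E \<union> F\<close>, the first case would give
      \<open>f (x, y) < n x + \<delta>\<^sub>2 < m y\<close>, the second
      \<open>f (x, y) < m y + \<delta>\<^sub>1 \<le> n x\<close>.\<close>
    then show "z \<in> E \<union> F"
      using m[of x y] n[of x y] by force
  qed
  finally have mixed: "card Q * card L + card P * card H \<le> card (E \<union> F)" .
  define D where "D = (E \<union> F) \<union> (P \<times> L \<union> Q \<times> H)"
  have "card (P \<times> L \<union> Q \<times> H) \<le> card P * card L + card Q * card H"
    by (metis card_Un_le card_cartesian_product)
  then have "card D \<le> 2 * card (E \<union> F)"
    using card_Un_le[of "E \<union> F" "P \<times> L \<union> Q \<times> H"] le mixed unfolding D_def by linarith
  also have "\<dots> \<le> 2 * (card E + card F)"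
    by (intro mult_left_mono card_Un_le) simp
  finally have "real (card D) \<le> real (2 * (card E + card F))"
    by (rule of_nat_mono)
  then have "real (card D) < 4 * \<epsilon> * real (card A) * real (card B)"
    using E(2) F(2) by simp
  moreover have "D \<subseteq> A \<times> B"
    using E(1) F(1) L(2) H(2) by (auto simp: D_def P_def Q_def)
  moreover have "T \<le> f (x, y) \<and> f (x, y) < T + (\<delta>\<^sub>1 + \<delta>\<^sub>2)"
    if "x \<in> A" "y \<in> B" "(x, y) \<notin> D" for x y
  proof -
    have "m y \<le> f (x, y)" "f (x, y) < m y + \<delta>\<^sub>1" "n x \<le> f (x, y)" "f (x, y) < n x + \<delta>\<^sub>2"
      using m[of x y] n[of x y] that by (auto simp: D_def)
    \<comment> \<open>The coordinates are neither both low nor both high. The weak bound on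
      \<open>m y\<close> is enough, since \<open>f (x, y) < m y + \<delta>\<^sub>1\<close> is
      strict.\<close>
    moreover have "T \<le> m y \<or> T \<le> n x" "m y \<le> T + \<delta>\<^sub>2 \<or> n x < T + \<delta>\<^sub>1"
      using that L(1) H(1) by (force simp: D_def P_def Q_def)+
    ultimately show ?thesis
      by linarith
  qed
  ultimately show ?thesis
    using fin by (intro almost_constantI)
qed

end
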